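(* For each $(n,k)\in\{(33,16),(36,17),(38,17),(38,18)\}$, there exists a binary LCD $[n,k,7]$ code.
   Context: A binary $[n,k,d]$ code is a $k$-dimensional linear subspace $C$ of $\mathbb{F}_2^n$ whose minimum nonzero Hamming weight is $d$. It is LCD (Euclidean linear complementary dual) if $C\cap C^{\perp}=\{0\}$, where $C^{\perp}=\{y\in\mathbb{F}_2^n:\sum_i x_iy_i=0\text{ for all }x\in C\}$. *)

theory Defs
  imports "HOL-Library.Z2" "Jordan_Normal_Form.VS_Connect"
begin

text \<open>
  The field with two elements is the type \<open>bit\<close>, and its \<open>n\<close>-dimensional coordinate space is
  \<open>carrier_vec n :: bit vec set\<close>, so that the length \<open>n\<close> is an ordinary natural number.
\<close>

definition hamming_weight :: "bit vec \<Rightarrow> nat" where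
  "hamming_weight x = card {i. i < dim_vec x \<and> x $ i \<noteq> 0}"

text \<open>The last two conjuncts say that \<open>d\<close> is the minimum of the weights of nonzero codewords, which
  entails that there is a nonzero codeword.\<close>

definition binary_code :: "nat \<Rightarrow> nat \<Rightarrow> nat \<Rightarrow> bit vec set \<Rightarrow> bool" where
  "binary_code n k d C \<longleftrightarrow>
     VectorSpace.subspace class_ring C (module_vec TYPE(bit) n) \<and>
     vectorspace.dim class_ring (module_vec TYPE(bit) n\<lparr>carrier := C\<rparr>) = k \<and>
     (\<exists>x\<in>C. x \<noteq> 0\<^sub>v n \<and> hamming_weight x = d) \<and>
     (\<forall>x\<in>C. x \<noteq> 0\<^sub>v n \<longrightarrow> d \<le> hamming_weight x)"

text \<open>\<open>vec_module.orthogonal_complement n C\<close> is the Euclidean dual code: the vectors \<open>x\<close> of length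
  \<open>n\<close> with \<open>x \<bullet> y = 0\<close> for all \<open>y\<close> in \<open>C\<close>.\<close>

definition lcd_code :: "nat \<Rightarrow> bit vec set \<Rightarrow> bool" where
  "lcd_code n C \<longleftrightarrow> C \<inter> vec_module.orthogonal_complement n C = {0\<^sub>v n}"

end

(* Each code is generated by the rows of [I | A], where A consists of consecutive cyclic shifts of a
   vector of weight 6, so that a single generator has weight 7. A codeword (u, v) of smaller weight
   would have at most three ones in u or at most two in v. The first case is excluded by inspecting
   the sums of at most three rows of A; the second by inspecting the sums of at most two rows of a
   right inverse N of A, since u = v N. This takes about a thousand sums instead of 2^k codewords.
   The code is LCD because the Gram matrix I + A A^T has an explicit inverse. The shifts and the
   inverses were found by a computer search; N, which is not unique, was chosen such that even
   sums of its rows that do not come from codewords satisfy the weight bound. *)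
theory Submission
  imports Defs
begin

section \<open>Executable linear algebra over F_2 on Boolean lists\<close>

fun xor_list :: "bool list \<Rightarrow> bool list \<Rightarrow> bool list" where
  "xor_list (x # xs) (y # ys) = (x \<noteq> y) # xor_list xs ys"
| "xor_list _ _ = []"

fun weight :: "bool list \<Rightarrow> nat" where
  "weight [] = 0"
| "weight (x # xs) = (if x then Suc (weight xs) else weight xs)"

fun parity_dot :: "bool list \<Rightarrow> bool list \<Rightarrow> bool" where
  "parity_dot (x # xs) (y # ys) = ((x \<and> y) \<noteq> parity_dot xs ys)"
| "parity_dot _ _ = False"

text \<open>The product of the row vector \<open>u\<close> with the matrix whose rows are
  \<open>R\<close>. The width \<open>m\<close> is a parameter because an empty matrix does not
  determine the length of the zero vector.\<close>

fun row_comb :: "nat \<Rightarrow> bool list list \<Rightarrow> bool list \<Rightarrow> bool list" where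
  "row_comb m (r # R) (b # u) =
     (if b then xor_list r (row_comb m R u) else row_comb m R u)"
| "row_comb m _ _ = replicate m False"

fun identity_rows :: "nat \<Rightarrow> bool list list" where
  "identity_rows 0 = []"
| "identity_rows (Suc k) = (True # replicate k False) # map ((#) False) (identity_rows k)"

lemma length_xor_list [simp]: "length xs = length ys \<Longrightarrow> length (xor_list xs ys) = length ys"
  by (induction xs ys rule: xor_list.induct) auto

lemma xor_list_assoc: "xor_list (xor_list xs ys) zs = xor_list xs (xor_list ys zs)"
proof (induction xs ys arbitrary: zs rule: xor_list.induct)
  case (1 x xs y ys)
  then show ?case by (cases zs) auto
qed auto

lemma xor_list_commute: "xor_list xs ys = xor_list ys xs"
  by (induction xs ys rule: xor_list.induct) auto

lemma xor_list_left_commute: "xor_list xs (xor_list ys zs) = xor_list ys (xor_list xs zs)"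
  by (metis xor_list_assoc xor_list_commute)

lemmas xor_list_ac = xor_list_assoc xor_list_commute xor_list_left_commute

lemma xor_list_replicate_False [simp]:
  "length xs = n \<Longrightarrow> xor_list xs (replicate n False) = xs"
  "length xs = n \<Longrightarrow> xor_list (replicate n False) xs = xs"
  by (induction xs arbitrary: n) auto

lemma xor_list_self: "xor_list xs xs = replicate (length xs) False"
  by (induction xs) auto

lemma xor_list_append:
  "length xs = length ys \<Longrightarrow>
     xor_list (xs @ xs') (ys @ ys') = xor_list xs ys @ xor_list xs' ys'"
  by (induction xs ys rule: xor_list.induct) auto

lemma weight_append [simp]: "weight (xs @ ys) = weight xs + weight ys"
  by (induction xs) auto

lemma weight_eq_0_iff: "weight xs = 0 \<longleftrightarrow> xs = replicate (length xs) False"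
  by (induction xs) auto

lemma weight_replicate_False [simp]: "weight (replicate n False) = 0"
  by (induction n) auto

lemma parity_dot_commute: "parity_dot xs ys = parity_dot ys xs"
  by (induction xs ys rule: parity_dot.induct) auto

lemma parity_dot_replicate_False [simp]:
  "\<not> parity_dot xs (replicate n False)" "\<not> parity_dot (replicate n False) xs"
proof -
  show "\<not> parity_dot xs (replicate n False)"
  proof (induction xs arbitrary: n)
    case (Cons x xs)
    then show ?case by (cases n) auto
  qed auto
  then show "\<not> parity_dot (replicate n False) xs"
    by (simp add: parity_dot_commute)
qed

lemma parity_dot_append:
  "length xs = length ys \<Longrightarrow>
     parity_dot (xs @ xs') (ys @ ys') = (parity_dot xs ys \<noteq> parity_dot xs' ys')"
  by (induction xs ys rule: parity_dot.induct) auto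

lemma parity_dot_xor_list:
  "length xs = length ys \<Longrightarrow>
     parity_dot (xor_list xs ys) zs = (parity_dot xs zs \<noteq> parity_dot ys zs)"
proof (induction xs ys arbitrary: zs rule: xor_list.induct)
  case (1 x xs y ys)
  then show ?case by (cases zs) auto
qed auto

lemma parity_dot_xor_list_right:
  "length ys = length zs \<Longrightarrow>
     parity_dot xs (xor_list ys zs) = (parity_dot xs ys \<noteq> parity_dot xs zs)"
  by (simp only: parity_dot_commute[of xs] parity_dot_xor_list)

lemma length_row_comb [simp]:
  "\<forall>r\<in>set R. length r = m \<Longrightarrow> length (row_comb m R u) = m"
  by (induction m R u rule: row_comb.induct) auto

lemma row_comb_replicate_False [simp]: "row_comb m R (replicate k False) = replicate m False"
proof (induction R arbitrary: k)
  case (Cons r R)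
  then show ?case by (cases k) auto
qed auto

lemma row_comb_xor_list:
  assumes "\<forall>r\<in>set R. length r = m" "length u = length v"
  shows "row_comb m R (xor_list u v) = xor_list (row_comb m R u) (row_comb m R v)"
  using assms
proof (induction R arbitrary: u v)
  case (Cons r R)
  show ?case
  proof (cases u)
    case (Cons x u')
    then obtain y v' where v: "v = y # v'" and len: "length u' = length v'"
      using Cons.prems(2) by (cases v) auto
    let ?u = "row_comb m R u'" and ?v = "row_comb m R v'"
    have l: "length r = m" "length ?u = m" "length ?v = m"
      using Cons.prems(1) by auto
    \<comment> \<open>This settles the case in which both leading bits are set: the leading bit of
      the sum is then clear, and the two copies of \<open>r\<close> must cancel.\<close>
    have "xor_list r (xor_list ?u (xor_list r ?v)) = xor_list ?u (xor_list (xor_list r r) ?v)"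
      by (simp add: xor_list_ac)
    also have "\<dots> = xor_list ?u ?v"
      using l by (simp add: xor_list_self)
    finally have "xor_list r (xor_list ?u (xor_list r ?v)) = xor_list ?u ?v" .
    then show ?thesis
      using Cons.IH[OF _ len] Cons.prems(1) l
      by (auto simp: \<open>u = x # u'\<close> v xor_list_assoc intro: xor_list_left_commute)
  next
    case Nil
    then show ?thesis using Cons.prems by simp
  qed
qed simp

text \<open>Associativity \<open>u (A N) = (u A) N\<close> of the matrix product, the rows of
  \<open>A N\<close> being the rows of \<open>A\<close> multiplied by \<open>N\<close>. It allows a
  message to be recovered from its check part.\<close>

lemma row_comb_map_row_comb:
  assumes "\<forall>r\<in>set N. length r = k" "\<forall>r\<in>set A. length r = m"
  shows "row_comb k (map (row_comb k N) A) u = row_comb k N (row_comb m A u)"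
  using assms
proof (induction A arbitrary: u)
  case (Cons r A)
  then show ?case
    by (cases u) (auto simp: row_comb_xor_list)
qed simp

lemma row_comb_map_Cons_False: "row_comb (Suc m) (map ((#) False) R) u = False # row_comb m R u"
proof (induction R arbitrary: u)
  case (Cons r R)
  then show ?case by (cases u) auto
qed simp

lemma row_comb_identity_rows: "length u = k \<Longrightarrow> row_comb k (identity_rows k) u = u"
proof (induction k arbitrary: u)
  case (Suc k)
  then obtain x u' where "u = x # u'" "length u' = k" by (cases u) auto
  with Suc.IH show ?case by (auto simp: row_comb_map_Cons_False)
qed simp

lemma parity_dot_identity_rows: "length u = k \<Longrightarrow> map (parity_dot u) (identity_rows k) = u"
proof (induction k arbitrary: u)
  case (Suc k)
  then obtain x u' where "u = x # u'" "length u' = k" by (cases u) auto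
  with Suc.IH[of u'] show ?case by (simp add: comp_def)
qed simp

text \<open>Moving \<open>A\<close> across the inner product as its transpose; this is how the Gram
  matrix arises when two codewords are multiplied.\<close>

lemma parity_dot_row_comb:
  assumes "\<forall>r\<in>set A. length r = m"
  shows "parity_dot (row_comb m A u) y = parity_dot u (map (\<lambda>r. parity_dot r y) A)"
  using assms
proof (induction A arbitrary: u)
  case (Cons r A)
  then show ?case
    by (cases u) (auto simp: parity_dot_xor_list)
qed simp

section \<open>Exhaustive search over sums of few rows\<close>

fun has_weight :: "nat \<Rightarrow> bool list \<Rightarrow> bool" where
  "has_weight 0 xs = True"
| "has_weight (Suc d) [] = False"
| "has_weight (Suc d) (x # xs) = has_weight (if x then d else Suc d) xs"

text \<open>Depth-first search sharing partial sums: \<open>acc\<close> is the sum of the rows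
  chosen so far and \<open>j\<close> bounds how many may still be added. Each chosen row puts a one
  into the message part, so the weight \<open>d\<close> still required drops by one.\<close>

fun sums_heavy :: "nat \<Rightarrow> nat \<Rightarrow> bool list list \<Rightarrow> bool list \<Rightarrow> bool" where
  "sums_heavy d 0 R acc = has_weight d acc"
| "sums_heavy d (Suc j) [] acc = has_weight d acc"
| "sums_heavy d (Suc j) (r # R) acc =
     (sums_heavy d (Suc j) R acc \<and> sums_heavy (d - 1) j R (xor_list acc r))"

text \<open>Starting a search from each possible first row leaves out the empty sum, for which a
  positive bound would fail.\<close>

fun nonzero_sums_heavy :: "nat \<Rightarrow> nat \<Rightarrow> bool list list \<Rightarrow> bool" where
  "nonzero_sums_heavy d j [] = True"
| "nonzero_sums_heavy d j (r # R) =
     (nonzero_sums_heavy d j R \<and> sums_heavy (d - 1) (j - 1) R r)"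

lemma has_weight_iff: "has_weight d xs \<longleftrightarrow> d \<le> weight xs"
  by (induction d xs rule: has_weight.induct) auto

lemma row_comb_weight_0: "weight u = 0 \<Longrightarrow> row_comb m R u = replicate m False"
  by (metis row_comb_replicate_False weight_eq_0_iff)

lemma sums_heavyD:
  assumes "sums_heavy d j R acc" "\<forall>r\<in>set R. length r = m" "length acc = m"
    and "weight u \<le> j" "length u = length R"
  shows "d \<le> weight u + weight (xor_list acc (row_comb m R u))"
  using assms
proof (induction d j R acc arbitrary: u rule: sums_heavy.induct)
  case (1 d R acc)
  then show ?case by (simp add: has_weight_iff row_comb_weight_0)
next
  case (2 d j acc)
  then show ?case by (simp add: has_weight_iff)
next
  case (3 d j r R acc)
  then obtain x u' where u: "u = x # u'" "length u' = length R" by (cases u) auto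
  show ?case
  proof (cases x)
    case True
    have "d - 1 \<le> weight u' + weight (xor_list (xor_list acc r) (row_comb m R u'))"
      by (rule "3.IH"(2)) (use "3.prems" u True in auto)
    \<comment> \<open>Associativity moves \<open>r\<close> from the accumulator back into the
      combination. Truncation in \<open>d - 1\<close> is harmless, since the set bit of
      \<open>u\<close> adds one to the right-hand side.\<close>
    then show ?thesis using u True by (simp add: xor_list_assoc)
  next
    case False
    have "d \<le> weight u' + weight (xor_list acc (row_comb m R u'))"
      by (rule "3.IH"(1)) (use "3.prems" u False in auto)
    then show ?thesis using u False by simp
  qed
qed

lemma nonzero_sums_heavyD:
  assumes "nonzero_sums_heavy d j R" "\<forall>r\<in>set R. length r = m"
    and "weight u \<le> j" "length u = length R" "weight u \<noteq> 0"
  shows "d \<le> weight u + weight (row_comb m R u)"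
  using assms
proof (induction d j R arbitrary: u rule: nonzero_sums_heavy.induct)
  case (1 d j)
  then show ?case by simp
next
  case (2 d j r R)
  then obtain x u' where u: "u = x # u'" "length u' = length R" by (cases u) auto
  show ?case
  proof (cases x)
    case True
    have "d - 1 \<le> weight u' + weight (xor_list r (row_comb m R u'))"
      by (rule sums_heavyD) (use "2.prems" u True in auto)
    then show ?thesis using u True by simp
  next
    case False
    have "d \<le> weight u' + weight (row_comb m R u')"
      by (rule "2.IH") (use "2.prems" u False in auto)
    then show ?thesis using u False by simp
  qed
qed

section \<open>Systematic encoding and certificates\<close>

definition encode :: "nat \<Rightarrow> bool list list \<Rightarrow> bool list \<Rightarrow> bool list" where
  "encode m A u = u @ row_comb m A u"

text \<open>\<open>A\<close> is the check part of the generators \<open>[I | A]\<close>, \<open>N\<close> a right inverse of \<open>A\<close>, \<open>P\<close> a left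
  inverse of the Gram matrix \<open>I + A A\<^sup>T\<close>, and \<open>u\<close> the message of a codeword of weight \<open>d\<close>.\<close>

definition lcd_certificate ::
  "nat \<Rightarrow> nat \<Rightarrow> nat \<Rightarrow> nat \<Rightarrow> nat \<Rightarrow> bool list list \<Rightarrow> bool list list \<Rightarrow> bool list list \<Rightarrow> bool list \<Rightarrow> bool"
  where
  "lcd_certificate d s t k m A N P u \<longleftrightarrow>
     d \<le> s + t + 2 \<and> 0 < d \<and>
     length A = k \<and> list_all (\<lambda>r. length r = m) A \<and>
     length N = m \<and> list_all (\<lambda>r. length r = k) N \<and>
     list_all (\<lambda>r. length r = k) P \<and>
     map (row_comb k N) A = identity_rows k \<and>
     map (\<lambda>p. xor_list p (map (\<lambda>r. parity_dot r (row_comb m A p)) A)) P = identity_rows k \<and>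
     nonzero_sums_heavy d s A \<and> nonzero_sums_heavy d t N \<and>
     length u = k \<and> weight (encode m A u) = d"

section \<open>Boolean lists as vectors over F_2\<close>

definition bit_vec :: "bool list \<Rightarrow> bit vec" where
  "bit_vec xs = vec_of_list (map of_bool xs)"

definition bool_list :: "bit vec \<Rightarrow> bool list" where
  "bool_list v = map (\<lambda>x. x = 1) (list_of_vec v)"

lemma dim_bit_vec [simp]: "dim_vec (bit_vec xs) = length xs"
  by (simp add: bit_vec_def)

lemma index_bit_vec: "i < length xs \<Longrightarrow> bit_vec xs $ i = of_bool (xs ! i)"
  by (simp add: bit_vec_def vec_of_list_index del: vec_of_list_map)

lemma length_bool_list [simp]: "length (bool_list v) = dim_vec v"
  by (simp add: bool_list_def)

lemma nth_bool_list: "i < dim_vec v \<Longrightarrow> bool_list v ! i \<longleftrightarrow> v $ i = 1"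
  by (simp add: bool_list_def list_of_vec_index)

lemma bit_vec_bool_list [simp]: "bit_vec (bool_list v) = v"
  by (rule eq_vecI) (auto simp: index_bit_vec nth_bool_list of_bool_def)

lemma bool_list_bit_vec [simp]: "bool_list (bit_vec xs) = xs"
  by (rule nth_equalityI) (auto simp: index_bit_vec nth_bool_list of_bool_def)

lemma nth_xor_list:
  "i < length xs \<Longrightarrow> i < length ys \<Longrightarrow> xor_list xs ys ! i = (xs ! i \<noteq> ys ! i)"
  by (induction xs ys arbitrary: i rule: xor_list.induct) (auto simp: nth_Cons split: nat.splits)

lemma bit_vec_xor_list:
  "length xs = length ys \<Longrightarrow> bit_vec (xor_list xs ys) = bit_vec xs + bit_vec ys"
  by (rule eq_vecI) (auto simp: index_bit_vec nth_xor_list of_bool_def)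

lemma bool_list_add:
  "dim_vec v = dim_vec w \<Longrightarrow> bool_list (v + w) = xor_list (bool_list v) (bool_list w)"
  by (metis bit_vec_bool_list bit_vec_xor_list bool_list_bit_vec length_bool_list)

lemma bit_vec_replicate_False: "bit_vec (replicate n False) = 0\<^sub>v n"
  by (rule eq_vecI) (auto simp: index_bit_vec)

lemma scalar_prod_bit_vec:
  "length xs = length ys \<Longrightarrow> bit_vec xs \<bullet> bit_vec ys = of_bool (parity_dot xs ys)"
proof (induction xs ys rule: parity_dot.induct)
  case (1 x xs y ys)
  then show ?case by (auto simp: bit_vec_def)
qed (auto simp: bit_vec_def)

lemma weight_conv_card: "weight xs = card {i. i < length xs \<and> xs ! i}"
proof -
  have "weight xs = length (filter (\<lambda>b. b) xs)"
    by (induction xs) auto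
  then show ?thesis by (simp add: length_filter_conv_card)
qed

lemma hamming_weight_bit_vec: "hamming_weight (bit_vec xs) = weight xs"
  unfolding hamming_weight_def weight_conv_card
  by (rule arg_cong[of _ _ card]) (auto simp: index_bit_vec)

lemma hamming_weight_zero: "hamming_weight (0\<^sub>v n) = 0"
  by (simp add: hamming_weight_bit_vec flip: bit_vec_replicate_False)

section \<open>From a certificate to a code\<close>

lemma lcd_certificateD:
  assumes cert: "lcd_certificate d s t k m A N P w"
  shows "\<exists>C. binary_code (k + m) k d C \<and> lcd_code (k + m) C"
proof -
  have A: "length A = k" "\<forall>r\<in>set A. length r = m"
    and N: "length N = m" "\<forall>r\<in>set N. length r = k"
    and P: "\<forall>r\<in>set P. length r = k"
    and inv: "map (row_comb k N) A = identity_rows k"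
    and gram: "map (\<lambda>p. xor_list p (map (\<lambda>r. parity_dot r (row_comb m A p)) A)) P = identity_rows k"
    and heavy: "nonzero_sums_heavy d s A" "nonzero_sums_heavy d t N"
    and d: "d \<le> s + t + 2" "0 < d"
    and w: "length w = k" "weight (encode m A w) = d"
    using cert by (auto simp: lcd_certificate_def list_all_iff)
  let ?T = "\<lambda>v. bit_vec (encode m A (bool_list v))"
  let ?V = "module_vec TYPE(bit) k" and ?W = "module_vec TYPE(bit) (k + m)"
  let ?C = "?T ` carrier_vec k"
  have length_encode: "length (encode m A u) = length u + m" for u
    using A by (simp add: encode_def)
  have min_weight: "d \<le> weight (encode m A u)" if u: "length u = k" "weight u \<noteq> 0" for u
  proof -
    let ?v = "row_comb m A u"
    \<comment> \<open>By \<open>A N = I\<close> the check part determines the message, so the two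
      halves of a codeword can exchange roles and the same search applies to
      \<open>N\<close>.\<close>
    have rec: "row_comb k N ?v = u"
      using row_comb_map_row_comb[OF N(2) A(2), of u] u inv by (simp add: row_comb_identity_rows)
    \<comment> \<open>The search in \<open>N\<close> speaks of nonempty sums only; a zero check part
      would give back a zero message.\<close>
    have "weight ?v \<noteq> 0"
      using rec row_comb_weight_0[of ?v k N] u(2) by (metis weight_replicate_False)
    consider "weight u \<le> s" | "weight ?v \<le> t" | "s < weight u" "t < weight ?v" by linarith
    then show ?thesis
    proof cases
      case 1
      then show ?thesis
        using nonzero_sums_heavyD[OF heavy(1) A(2)] u A(1) by (simp add: encode_def)
    next
      case 2
      then have "d \<le> weight ?v + weight (row_comb k N ?v)"
        by (intro nonzero_sums_heavyD[OF heavy(2) N(2)]) (use A N \<open>weight ?v \<noteq> 0\<close> in auto)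
      then show ?thesis by (simp add: encode_def rec)
    next
      \<comment> \<open>At least \<open>s + 1\<close> ones in the message and \<open>t + 1\<close>
        in the check part, which suffices by the bound on \<open>d\<close> in the
        certificate.\<close>
      case 3
      then show ?thesis using d by (simp add: encode_def)
    qed
  qed
  have zero: "?T (0\<^sub>v k) = 0\<^sub>v (k + m)"
  proof -
    have "bool_list (0\<^sub>v k) = replicate k False"
      by (metis bit_vec_replicate_False bool_list_bit_vec)
    then show ?thesis
      by (simp add: encode_def bit_vec_replicate_False flip: replicate_add)
  qed
  have add: "?T (v + v') = ?T v + ?T v'" if "v \<in> carrier_vec k" "v' \<in> carrier_vec k" for v v'
    using that A
    by (simp add: bool_list_add encode_def row_comb_xor_list bit_vec_xor_list
        flip: xor_list_append)
  have smult: "?T (c \<cdot>\<^sub>v v) = c \<cdot>\<^sub>v ?T v" if v: "v \<in> carrier_vec k" for c v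
  \<comment> \<open>The only other scalar is 1, for which the claim is immediate.\<close>
  proof (cases "c = 0")
    case True
    then have "c \<cdot>\<^sub>v v = 0\<^sub>v k" "c \<cdot>\<^sub>v ?T v = 0\<^sub>v (k + m)"
      using v by (auto simp: length_encode)
    then show ?thesis using zero by simp
  qed simp
  interpret vs: vec_space "TYPE(bit)" k .
  interpret W: vec_space "TYPE(bit)" "k + m" .
  interpret lin: linear_map class_ring ?V ?W ?T
  proof unfold_locales
    show "?T \<in> LinearCombinations.module_hom class_ring ?V ?W"
      unfolding LinearCombinations.module_hom_def
      using A add smult
      by (auto simp: module_vec_simps length_encode intro!: carrier_vecI)
  qed
  have im: "lin.imT = ?C"
    by (simp add: lin.im_def module_vec_simps)
  have codeword: "bit_vec (encode m A u) \<in> ?C" if "length u = k" for u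
    using that by (intro image_eqI[of _ _ "bit_vec u"]) (auto intro!: carrier_vecI)
  have C_D: "\<exists>u. length u = k \<and> x = bit_vec (encode m A u)" if "x \<in> ?C" for x
    using that by (metis (no_types, lifting) carrier_vecD imageE length_bool_list)
  \<comment> \<open>The first \<open>k\<close> coordinates of a codeword are its message. Hence the
    kernel is trivial, and rank-nullity gives the image dimension \<open>k\<close>.\<close>
  have "inj_on ?T (carrier_vec k)"
  proof (rule inj_onI)
    fix v v' assume v: "v \<in> carrier_vec k" "v' \<in> carrier_vec k" and "?T v = ?T v'"
    then have "encode m A (bool_list v) = encode m A (bool_list v')"
      by (metis bool_list_bit_vec)
    then have "bool_list v = bool_list v'"
      using v by (simp add: encode_def)
    then show "v = v'"
      by (metis bit_vec_bool_list)
  qed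
  then have "vectorspace.dim class_ring (?V\<lparr>carrier := lin.kerT\<rparr>) = 0"
    by (intro lin.inj_imp_dim_ker0) (simp add: module_vec_simps)
  then have "vectorspace.dim class_ring (?W\<lparr>carrier := ?C\<rparr>) = k"
    using lin.rank_nullity vs.fin_dim vs.dim_is_n by (simp add: im)
  moreover have "VectorSpace.subspace class_ring ?C ?W"
    using lin.imT_is_subspace by (simp add: im)
  moreover have "d \<le> hamming_weight x" if x: "x \<in> ?C" "x \<noteq> 0\<^sub>v (k + m)" for x
  proof -
    obtain u where u: "length u = k" "x = bit_vec (encode m A u)"
      using C_D[OF x(1)] by blast
    have "weight u \<noteq> 0"
    proof
      assume "weight u = 0"
      then have "bit_vec u = 0\<^sub>v k"
        using u(1) bit_vec_replicate_False[of k] unfolding weight_eq_0_iff by metis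
      then show False
        using zero x(2) u(2) by (metis bool_list_bit_vec)
    qed
    then show ?thesis
      using min_weight u by (simp add: hamming_weight_bit_vec)
  qed
  moreover have "\<exists>x\<in>?C. x \<noteq> 0\<^sub>v (k + m) \<and> hamming_weight x = d"
  proof (intro bexI conjI)
    show "hamming_weight (bit_vec (encode m A w)) = d"
      using w(2) by (simp add: hamming_weight_bit_vec)
    with \<open>0 < d\<close> show "bit_vec (encode m A w) \<noteq> 0\<^sub>v (k + m)"
      by (auto simp: hamming_weight_zero)
  qed (rule codeword[OF w(1)])
  ultimately have "binary_code (k + m) k d ?C"
    unfolding binary_code_def by blast
  moreover have "lcd_code (k + m) ?C"
  proof -
    have "x = 0\<^sub>v (k + m)" if x: "x \<in> ?C" "\<forall>y\<in>?C. x \<bullet> y = 0" for x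
    proof -
      obtain u where u: "length u = k" "x = bit_vec (encode m A u)"
        using C_D[OF x(1)] by blast
      have "\<not> parity_dot u e" if e_row: "e \<in> set (identity_rows k)" for e
      proof -
        \<comment> \<open>Each unit vector \<open>e\<close> is \<open>p (I + A A^T)\<close> for some
          row \<open>p\<close> of \<open>P\<close>. The product of the codewords of \<open>u\<close>
          and \<open>p\<close> is \<open>u . p + uA . pA\<close>, which recombines to
          \<open>u . e\<close>, so orthogonality of \<open>x\<close> to the code makes
          \<open>u . e\<close> vanish.\<close>
        obtain p where p: "p \<in> set P"
          and e: "e = xor_list p (map (\<lambda>r. parity_dot r (row_comb m A p)) A)"
          using e_row unfolding gram[symmetric] set_map by blast
        have lp: "length p = k" using P p by blast
        have "x \<bullet> bit_vec (encode m A p) = 0"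
          using x(2) codeword[OF lp] by blast
        then have "\<not> parity_dot (encode m A u) (encode m A p)"
          using u lp A by (simp add: scalar_prod_bit_vec length_encode)
        then show ?thesis
          using u lp A
          by (simp add: e encode_def parity_dot_append parity_dot_row_comb parity_dot_xor_list_right)
      qed
      \<comment> \<open>The entries of \<open>u\<close> are its products with the unit vectors, all
        of which have just been shown to vanish.\<close>
      moreover have "set u = parity_dot u ` set (identity_rows k)"
        using arg_cong[OF parity_dot_identity_rows[OF u(1)], of set] by (simp only: set_map)
      ultimately have "u = replicate k False"
        using u(1) by (intro replicate_eqI) auto
      then show ?thesis
        by (simp add: u(2) encode_def flip: replicate_add bit_vec_replicate_False)
    qed
    moreover have "0\<^sub>v (k + m) \<in> ?C"
      using zero by (metis image_eqI zero_carrier_vec)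
    moreover have "?C \<subseteq> carrier_vec (k + m)"
      using A by (auto simp: length_encode intro!: carrier_vecI)
    then have "\<forall>y\<in>?C. 0\<^sub>v (k + m) \<bullet> y = 0"
      using scalar_prod_left_zero by blast
    moreover have "0\<^sub>v (k + m) \<in> carrier_vec (k + m)"
      by simp
    ultimately show ?thesis
      unfolding lcd_code_def W.orthogonal_complement_def by blast
  qed
  ultimately show ?thesis by blast
qed

section \<open>The four certificates\<close>

fun bits :: "nat \<Rightarrow> int \<Rightarrow> bool list" where
  "bits 0 x = []"
| "bits (Suc n) x = odd x # bits n (x div 2)"

text \<open>For \<open>k\<close> at most \<open>m\<close>, the first \<open>k\<close> rows of an
  \<open>m\<close> by \<open>m\<close> circulant matrix. Its first row is the binary expansion of
  \<open>a\<close>, least significant bit first, and each further row is shifted one place to the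
  left.\<close>

definition circulant_rows :: "nat \<Rightarrow> nat \<Rightarrow> int \<Rightarrow> bool list list" where
  "circulant_rows k m a = map (\<lambda>i. rotate i (bits m a)) [0..<k]"

text \<open>Here 303 = 1 + 2 + 4 + 8 + 32 + 256 encodes a row of weight 6. The message
  \<open>bits 16 1\<close> is the first unit vector, so its codeword is the first generator, of
  weight 1 + 6. The search depths 3 and 2 meet the bound 7 = 3 + 2 + 2 exactly. The other three
  certificates follow the same pattern.\<close>

lemma certificate_33_16:
  "lcd_certificate 7 3 2 16 17 (circulant_rows 16 17 303)
    (map (bits 16)
      [55987, 13327, 17233, 30974, 39638, 60354, 54088, 53005, 16080, 47553, 1462, 42098, 62608,
      56545, 14118, 48442, 63540])
    (map (bits 16)
      [23401, 46802, 16400, 56137, 39718, 16529, 55883, 39202, 17561, 53851, 35074, 25817, 37595,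
      2050, 19309, 38618])
    (bits 16 1)"
  by code_simp

lemma certificate_36_17:
  "lcd_certificate 7 3 2 17 19 (circulant_rows 17 19 16431)
    (map (bits 17)
      [75092, 129086, 11725, 20039, 115908, 100598, 5545, 21109, 117469, 67209, 90275, 86966,
      115535, 47366, 79383, 50090, 68417, 56577, 101735])
    (map (bits 17)
      [77641, 5440, 10880, 96841, 48960, 97920, 104859, 96484, 103763, 20029, 111411, 765, 1530,
      74941, 680, 1360, 75241])
    (bits 17 1)"
  by code_simp

lemma certificate_38_17:
  "lcd_certificate 7 3 2 17 21 (circulant_rows 17 21 8271)
    (map (bits 17)
      [87273, 123139, 6648, 58064, 99064, 19885, 119315, 49090, 3711, 36027, 44836, 47550,
      110415, 105680, 123063, 50285, 13565, 101446, 38845, 49242, 85746])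
    (map (bits 17)
      [32772, 98316, 9359, 18718, 4664, 9328, 18656, 4548, 9096, 18192, 3620, 7240, 14480, 61732,
      123464, 24579, 16386])
    (bits 17 1)"
  by code_simp

lemma certificate_38_18:
  "lcd_certificate 7 3 2 18 20 (circulant_rows 18 20 4143)
    (map (bits 18)
      [245833, 215475, 200014, 232536, 49648, 158215, 37303, 126063, 86659, 69109, 74318, 104187,
      156394, 211850, 39449, 189595, 252890, 255762, 62549, 185277])
    (map (bits 18)
      [73156, 146312, 27669, 55338, 110676, 221352, 247697, 166371, 67779, 199746, 204357,
      141199, 21531, 43062, 86124, 172248, 18289, 36578])
    (bits 18 1)"
  by code_simp

theorem corollary4p7:
  shows "\<forall>(n, k) \<in> {(33, 16), (36, 17), (38, 17), (38, 18)}.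
           \<exists>C. binary_code n k 7 C \<and> lcd_code n C"
  using certificate_33_16[THEN lcd_certificateD] certificate_36_17[THEN lcd_certificateD]
    certificate_38_17[THEN lcd_certificateD] certificate_38_18[THEN lcd_certificateD]
  by auto

end
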